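(* Let $m,n,r$ be positive integers with $\min(m,n)\ge 2r$, let $\xi\ge 0$ and $q\in[1,\infty]$ (with $1/\infty=0$). Define $$\mathcal{F}_r(\xi) = \left\{(\widetilde{\mathbf{A}},\widetilde{\mathbf{Z}},\widetilde{\mathbf{B}}) \in (\mathbb{R}^{m\times n})^3:\ \widetilde{\mathbf{B}} = \widetilde{\mathbf{A}}+\widetilde{\mathbf{Z}},\ \mathrm{rank}(\widetilde{\mathbf{A}}) = r,\ \|\widetilde{\mathbf{Z}}_{\max(r)}\|_q\le \xi\right\}.$$ Then $$\inf_{\check{\mathbf{A}}}\ \sup_{(\widetilde{\mathbf{A}},\widetilde{\mathbf{Z}},\widetilde{\mathbf{B}})\in\mathcal{F}_r(\xi)} \left\|\check{\mathbf{A}}(\widetilde{\mathbf{B}}) - \widetilde{\mathbf{A}}\right\|_q \ \ge\ 2^{1/q-1}\,\xi,$$ where the infimum is taken over all estimation procedures $\check{\mathbf{A}}$, i.e. all (deterministic or random) functions $\check{\mathbf{A}}:\mathbb{R}^{m\times n}\to\mathbb{R}^{m\times n}$ of the observed matrix; for a random function the supremum is read for each realization of the function.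
   Context: For $\mathbf{M}\in\mathbb{R}^{m\times n}$ with singular values $\sigma_1(\mathbf{M})\ge\cdots\ge\sigma_{\min(m,n)}(\mathbf{M})\ge 0$, the Schatten-$q$ norm is $\|\mathbf{M}\|_q = \left(\sum_{i=1}^{\min(m,n)} \sigma_i(\mathbf{M})^q\right)^{1/q}$ for $1\le q<\infty$, and $\|\mathbf{M}\|_\infty = \sigma_1(\mathbf{M})$ is the spectral norm. Given a singular value decomposition $\mathbf{M} = \sum_{i}\sigma_i(\mathbf{M})\mathbf{u}_i\mathbf{v}_i^\top$ with decreasing singular values, $\mathbf{M}_{\max(r)} = \sum_{i=1}^r \sigma_i(\mathbf{M})\mathbf{u}_i\mathbf{v}_i^\top$ is the best rank-$r$ approximation of $\mathbf{M}$. *)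

theory Defs
  imports "HOL-Analysis.Analysis" "HOL-Probability.Probability"
begin

definition outer_product :: "real^'m \<Rightarrow> real^'n \<Rightarrow> real^'n^'m" where
  "outer_product x y = (\<chi> i j. x $ i * y $ j)"

text \<open>
  A singular value decomposition of \<open>M\<close>, in which \<open>s i\<close>, \<open>u i\<close> and \<open>v i\<close> are indexed by
  \<open>i = 1, \<dots>, min(m, n)\<close>; values at other indices are irrelevant. The type
  \<^typ>\<open>real^'n^'m\<close> has \<open>m = CARD('m)\<close> rows and \<open>n = CARD('n)\<close> columns.
\<close>

definition is_svd ::
  "real^'n^'m \<Rightarrow> (nat \<Rightarrow> real) \<Rightarrow> (nat \<Rightarrow> real^'m) \<Rightarrow> (nat \<Rightarrow> real^'n) \<Rightarrow> bool" where
  "is_svd M s u v \<longleftrightarrow>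
     (let K = {1..min CARD('m) CARD('n)} in
       (\<forall>i\<in>K. 0 \<le> s i) \<and>
       (\<forall>i\<in>K. \<forall>j\<in>K. i \<le> j \<longrightarrow> s j \<le> s i) \<and>
       (\<forall>i\<in>K. \<forall>j\<in>K. u i \<bullet> u j = (if i = j then 1 else 0)) \<and>
       (\<forall>i\<in>K. \<forall>j\<in>K. v i \<bullet> v j = (if i = j then 1 else 0)) \<and>
       M = (\<Sum>i\<in>K. s i *\<^sub>R outer_product (u i) (v i)))"

text \<open>
  The \<open>i\<close>-th largest singular value, for \<open>1 \<le> i \<le> min(m, n)\<close>. Every real matrix has a singular
  value decomposition and all of them have the same \<open>s i\<close>, so the description is proper.
\<close>

definition singular_value :: "real^'n^'m \<Rightarrow> nat \<Rightarrow> real" where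
  "singular_value M i = (THE x. \<exists>s u v. is_svd M s u v \<and> x = s i)"

definition schatten_norm :: "ereal \<Rightarrow> real^'n^'m \<Rightarrow> real" where
  "schatten_norm q M =
     (if q = \<infinity> then singular_value M 1
      else (\<Sum>i = 1..min CARD('m) CARD('n). singular_value M i powr real_of_ereal q)
             powr (1 / real_of_ereal q))"

text \<open>
  The truncation of \<open>M\<close> to its leading \<open>r\<close> singular triples, for \<open>r \<le> min(m, n)\<close>. If the
  \<open>r\<close>-th and the next singular value coincide, this matrix depends on the decomposition
  that is chosen, but its singular values do not.
\<close>

definition max_part :: "nat \<Rightarrow> real^'n^'m \<Rightarrow> real^'n^'m" where
  "max_part r M =
     (SOME N. \<exists>s u v. is_svd M s u v \<and>
        N = (\<Sum>i = 1..r. s i *\<^sub>R outer_product (u i) (v i)))"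

definition perturbation_class ::
  "nat \<Rightarrow> ereal \<Rightarrow> real \<Rightarrow> ((real^'n^'m) \<times> (real^'n^'m) \<times> (real^'n^'m)) set" where
  "perturbation_class r q \<xi> =
     {(A, Z, B). B = A + Z \<and> rank A = r \<and> schatten_norm q (max_part r Z) \<le> \<xi>}"

text \<open>
  Random functions on the sample space of \<open>P\<close>: the first argument is the outcome, so \<open>F \<omega>\<close> is the
  realization at \<open>\<omega>\<close>, and the value at each fixed matrix is a random variable.
\<close>

definition random_estimators :: "'w measure \<Rightarrow> ('w \<Rightarrow> real^'n^'m \<Rightarrow> real^'n^'m) set" where
  "random_estimators P = {F. \<forall>B. (\<lambda>\<omega>. F \<omega> B) \<in> borel_measurable P}"

text \<open>The supremum is taken in the extended reals since the error may be unbounded on the class.\<close>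

definition worst_case_error ::
  "nat \<Rightarrow> ereal \<Rightarrow> real \<Rightarrow> (real^'n^'m \<Rightarrow> real^'n^'m) \<Rightarrow> ereal" where
  "worst_case_error r q \<xi> f =
     (SUP (A, Z, B) \<in> perturbation_class r q \<xi>. ereal (schatten_norm q (f B - A)))"

end

theory Submission
  imports Defs
begin

text \<open>
  This is a two-point lower bound. Fix orthonormal families \<open>u\<close>, \<open>v\<close> and put
  \<open>A\<^sub>1 = c \<Sum>\<^bsub>i\<le>r\<^esub> u\<^sub>i v\<^sub>i\<^sup>T\<close> and \<open>A\<^sub>2 = c \<Sum>\<^bsub>r<i\<le>2r\<^esub> u\<^sub>i v\<^sub>i\<^sup>T\<close>. The
  observation \<open>B = A\<^sub>1 + A\<^sub>2\<close> arises from the signal \<open>A\<^sub>1\<close> with noise \<open>A\<^sub>2\<close> and equally from the signal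
  \<open>A\<^sub>2\<close> with noise \<open>A\<^sub>1\<close>. With \<open>c = \<xi> / r\<^bsup>1/q\<^esup>\<close> both noises have Schatten norm \<open>\<xi>\<close>, and any value
  \<open>X\<close> of the estimator at \<open>B\<close> is far from one of the two signals.

  The triangle inequality for Schatten norms would give this last claim; testing against one fixed
  matrix is enough. Let \<open>W\<close> be the partial isometry \<open>(A\<^sub>1 - A\<^sub>2) / c\<close> of rank \<open>2r\<close>. Since
  \<open>\<langle>X - A\<^sub>2, W\<rangle> + \<langle>X - A\<^sub>1, -W\<rangle> = 2rc\<close>, one of the two pairings is at least \<open>rc\<close>. A Hoelder inequality
  for partial isometries (\<open>schatten_norm_lower_bound\<close>) turns this into the lower bound
  \<open>(2r)\<^bsup>1/q\<^esup> c / 2 = 2\<^bsup>1/q - 1\<^esup> \<xi>\<close> for the norm of that error.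

  The basis of that inequality is \<open>svd_inner_partial_isometry\<close>: for \<open>M\<close> with singular values \<open>s\<^sub>i\<close> and a
  partial isometry \<open>W\<close> of rank \<open>k\<close>, \<open>\<langle>M, W\<rangle> = \<Sum>\<^sub>i s\<^sub>i w\<^sub>i\<close> where \<open>\<bar>w\<^sub>i\<bar> \<le> 1\<close> and \<open>\<Sum>\<^sub>i \<bar>w\<^sub>i\<bar> \<le> k\<close>. It also gives
  one half of Ky Fan's variational principle, and from it the uniqueness of the singular values.
  Their existence (\<open>svd_exists\<close>) follows by maximising the form \<open>y\<^sup>T M x\<close> over unit vectors
  repeatedly, each time on the orthogonal complement of the vectors found before.
\<close>

section \<open>Orthonormal families\<close>

text \<open>The family is indexed, so orthonormality includes injectivity of \<open>a\<close> on \<open>J\<close>.\<close>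

definition orthonormal_on :: "'i set \<Rightarrow> ('i \<Rightarrow> 'a::real_inner) \<Rightarrow> bool" where
  "orthonormal_on J a \<longleftrightarrow> (\<forall>i\<in>J. \<forall>j\<in>J. a i \<bullet> a j = (if i = j then 1 else 0))"

lemma orthonormal_on_subset: "orthonormal_on J a \<Longrightarrow> I \<subseteq> J \<Longrightarrow> orthonormal_on I a"
  unfolding orthonormal_on_def by blast

lemma orthonormal_on_reindex:
  "orthonormal_on J a \<Longrightarrow> inj_on \<pi> I \<Longrightarrow> \<pi> ` I \<subseteq> J \<Longrightarrow> orthonormal_on I (a \<circ> \<pi>)"
  unfolding orthonormal_on_def by (simp add: inj_on_eq_iff image_subset_iff)

lemma orthonormal_on_Suc:
  assumes "orthonormal_on {1..k} a" "norm x = 1" "\<And>i. i \<in> {1..k} \<Longrightarrow> x \<bullet> a i = 0"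
  shows "orthonormal_on {1..Suc k} (a(Suc k := x))"
proof -
  have "x \<bullet> x = 1" using assms(2) by (simp add: norm_eq_1)
  moreover have "a i \<bullet> x = 0" if "i \<in> {1..k}" for i
    using assms(3)[OF that] by (simp add: inner_commute)
  ultimately show ?thesis using assms(1,3)
    unfolding orthonormal_on_def by (auto simp: le_Suc_eq)
qed

lemma orthonormal_on_inner_sum:
  assumes "finite J" "orthonormal_on J a" "i \<in> J"
  shows "a i \<bullet> (\<Sum>j\<in>J. t j *\<^sub>R a j) = t i"
proof -
  have "a i \<bullet> (\<Sum>j\<in>J. t j *\<^sub>R a j) = (\<Sum>j\<in>J. if j = i then t j else 0)"
    unfolding inner_sum_right using assms(2,3)
    by (intro sum.cong) (auto simp: orthonormal_on_def)
  then show ?thesis using assms by simp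
qed

lemma bessel_inequality:
  assumes "finite J" "orthonormal_on J a"
  shows "(\<Sum>j\<in>J. (x \<bullet> a j)\<^sup>2) \<le> x \<bullet> x"
proof -
  define p where "p = (\<Sum>j\<in>J. (x \<bullet> a j) *\<^sub>R a j)"
  have xp: "x \<bullet> p = (\<Sum>j\<in>J. (x \<bullet> a j)\<^sup>2)"
    unfolding p_def inner_sum_right by (simp add: power2_eq_square)
  have "p \<bullet> p = (\<Sum>j\<in>J. (x \<bullet> a j) * (a j \<bullet> p))"
    by (subst p_def) (simp add: inner_sum_left)
  also have "\<dots> = (\<Sum>j\<in>J. (x \<bullet> a j)\<^sup>2)"
    by (intro sum.cong)
      (simp_all add: p_def orthonormal_on_inner_sum[OF assms] power2_eq_square)
  finally have pp: "p \<bullet> p = (\<Sum>j\<in>J. (x \<bullet> a j)\<^sup>2)" .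
  have "0 \<le> (x - p) \<bullet> (x - p)" by simp
  also have "\<dots> = x \<bullet> x - 2 * (x \<bullet> p) + p \<bullet> p"
    by (simp add: inner_diff_left inner_diff_right inner_commute)
  finally show ?thesis using xp pp by simp
qed

lemma orthonormal_on_independent:
  assumes "orthonormal_on J a"
  shows "inj_on a J" "independent (a ` J)"
proof -
  show "inj_on a J"
    using assms unfolding orthonormal_on_def inj_on_def by (metis zero_neq_one)
  have "0 \<notin> a ` J"
    using assms unfolding orthonormal_on_def by (metis image_iff inner_zero_left zero_neq_one)
  moreover have "pairwise orthogonal (a ` J)"
    using assms unfolding orthonormal_on_def pairwise_def orthogonal_def by auto
  ultimately show "independent (a ` J)"
    by (simp add: pairwise_orthogonal_independent)
qed

lemma orthonormal_on_complete:
  fixes a :: "'i \<Rightarrow> 'a::euclidean_space"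
  assumes "finite J" "orthonormal_on J a" "card J = DIM('a)" and z: "\<And>j. j \<in> J \<Longrightarrow> z \<bullet> a j = 0"
  shows "z = 0"
proof -
  have "card (a ` J) = DIM('a)"
    using assms orthonormal_on_independent(1) by (metis card_image)
  then have "span (a ` J) = UNIV"
    using orthonormal_on_independent(2)[OF assms(2)]
    by (metis dim_eq_card_independent dim_eq_full)
  then have "z \<in> span (a ` J)" by simp
  then have "orthogonal z z"
    by (rule orthogonal_to_span) (use z in \<open>auto simp: orthogonal_def inner_commute\<close>)
  then show ?thesis by (simp add: orthogonal_def)
qed

lemma unit_vector_orthogonal_to_family:
  fixes a :: "'i \<Rightarrow> 'a::euclidean_space"
  assumes "finite J" "card J < DIM('a)"
  obtains x where "norm x = 1" "\<And>j. j \<in> J \<Longrightarrow> x \<bullet> a j = 0"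
proof -
  have "dim (a ` J) < DIM('a)"
    using assms by (meson card_image_le dim_le_card' finite_imageI le_less_trans)
  then obtain x where x: "x \<noteq> 0" "\<And>y. y \<in> span (a ` J) \<Longrightarrow> orthogonal x y"
    using orthogonal_to_subspace_exists by blast
  show thesis
  proof
    show "norm (sgn x) = 1" using x by (simp add: norm_sgn)
    show "sgn x \<bullet> a j = 0" if "j \<in> J" for j
      using x(2)[of "a j"] that by (simp add: span_base orthogonal_def sgn_div_norm)
  qed
qed

section \<open>Outer products and the Frobenius inner product\<close>

lemma outer_product_mult_vec: "outer_product x y *v z = (y \<bullet> z) *\<^sub>R x"
  by (simp add: vec_eq_iff outer_product_def matrix_vector_mult_def inner_vec_def
      sum_distrib_left mult_ac)

lemma inner_outer_product: "M \<bullet> outer_product x y = x \<bullet> (M *v y)"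
  for M :: "real^'n^'m"
  by (simp add: outer_product_def matrix_vector_mult_def inner_vec_def
      sum_distrib_left mult_ac)

lemma sum_mult_vec: "sum f I *v x = (\<Sum>i\<in>I. f i *v x)"
  for f :: "'i \<Rightarrow> real^'n^'m"
  by (induction I rule: infinite_finite_induct) (simp_all add: matrix_vector_mult_add_rdistrib)

lemma sum_outer_product_mult_vec:
  "(\<Sum>i\<in>I. s i *\<^sub>R outer_product (u i) (v i)) *v x = (\<Sum>i\<in>I. (s i * (v i \<bullet> x)) *\<^sub>R u i)"
  by (simp add: sum_mult_vec outer_product_mult_vec flip: scaleR_matrix_vector_assoc)

lemma rank_sum_outer_product:
  fixes u :: "'i \<Rightarrow> real^'m" and v :: "'i \<Rightarrow> real^'n"
  assumes "finite S" "orthonormal_on S u" "orthonormal_on S v" "c \<noteq> 0"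
  shows "rank (\<Sum>i\<in>S. c *\<^sub>R outer_product (u i) (v i)) = card S"
proof -
  let ?M = "\<Sum>i\<in>S. c *\<^sub>R outer_product (u i) (v i)"
  have Mx: "?M *v x = (\<Sum>i\<in>S. (c * (v i \<bullet> x)) *\<^sub>R u i)" for x
    by (rule sum_outer_product_mult_vec)
  have "?M *v ((1 / c) *\<^sub>R v i) = u i" if "i \<in> S" for i
  proof -
    have "?M *v ((1 / c) *\<^sub>R v i) = (\<Sum>j\<in>S. if j = i then u j else 0)"
      unfolding Mx using assms that by (intro sum.cong) (auto simp: orthonormal_on_def)
    then show ?thesis using assms(1) that by simp
  qed
  then have "u i \<in> range (\<lambda>x. ?M *v x)" if "i \<in> S" for i
    using that by (blast intro: range_eqI[OF sym])
  then have "u ` S \<subseteq> range (\<lambda>x. ?M *v x)" by (rule image_subsetI)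
  moreover have "range (\<lambda>x. ?M *v x) \<subseteq> span (u ` S)"
    unfolding Mx by (intro image_subsetI span_sum span_scale) (auto intro: span_base)
  ultimately have "dim (range (\<lambda>x. ?M *v x)) = card (u ` S)"
    using orthonormal_on_independent(2)[OF assms(2)]
    by (rule dim_unique) (rule refl)
  then show ?thesis
    using orthonormal_on_independent(1)[OF assms(2)] by (simp add: rank_dim_range card_image)
qed

section \<open>Existence of a singular value decomposition\<close>

text \<open>
  The first \<open>k\<close> singular triples of \<open>M\<close>. The last clause, that the form \<open>y\<^sup>T M x\<close> is at most every
  earlier singular value on the orthogonal complements, keeps the next value found by maximisation
  in decreasing order.
\<close>

definition partial_svd ::
  "nat \<Rightarrow> real^'n^'m \<Rightarrow> (nat \<Rightarrow> real) \<Rightarrow> (nat \<Rightarrow> real^'m) \<Rightarrow> (nat \<Rightarrow> real^'n) \<Rightarrow> bool" where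
  "partial_svd k M s u v \<longleftrightarrow>
     orthonormal_on {1..k} u \<and> orthonormal_on {1..k} v \<and>
     (\<forall>i\<in>{1..k}. 0 \<le> s i \<and> M *v v i = s i *\<^sub>R u i \<and> u i v* M = s i *\<^sub>R v i) \<and>
     (\<forall>i\<in>{1..k}. \<forall>j\<in>{1..k}. i \<le> j \<longrightarrow> s j \<le> s i) \<and>
     (\<forall>x y. norm x = 1 \<longrightarrow> norm y = 1 \<longrightarrow> (\<forall>i\<in>{1..k}. x \<bullet> v i = 0 \<and> y \<bullet> u i = 0) \<longrightarrow>
        (\<forall>i\<in>{1..k}. y \<bullet> (M *v x) \<le> s i))"

text \<open>
  The equality case of Cauchy-Schwarz. It makes a maximiser \<open>(y, x)\<close> of the bilinear form of \<open>M\<close>, with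
  maximum \<open>t\<close>, satisfy \<open>M x = t y\<close> and \<open>M\<^sup>T y = t x\<close>.
\<close>

lemma unit_vector_extremal_eq:
  fixes y z :: "'a::real_inner"
  assumes "norm y = 1" "y \<bullet> z = t" "z \<bullet> z \<le> t * norm z" "0 \<le> t"
  shows "z = t *\<^sub>R y"
proof -
  have "norm z * norm z \<le> t * norm z"
    using assms(3) by (simp flip: power2_norm_eq_inner power2_eq_square)
  then have "norm z \<le> t"
    using assms(4) by (cases "norm z = 0") (auto simp: mult_le_cancel_right)
  then have "z \<bullet> z \<le> t * t"
    using assms(3,4) by (meson mult_left_mono order_trans)
  moreover have "(z - t *\<^sub>R y) \<bullet> (z - t *\<^sub>R y) = z \<bullet> z - 2 * t * (y \<bullet> z) + t * t * (y \<bullet> y)"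
    by (simp add: inner_diff_left inner_diff_right inner_commute algebra_simps)
  ultimately have "(z - t *\<^sub>R y) \<bullet> (z - t *\<^sub>R y) \<le> 0"
    using assms(1,2) by (simp add: norm_eq_1)
  then show ?thesis
    by (metis eq_iff_diff_eq_0 inner_eq_zero_iff inner_ge_zero order_antisym)
qed

lemma partial_svd_Suc:
  fixes M :: "real^'n^'m"
  assumes P: "partial_svd k M s u v" and k: "k < CARD('m)" "k < CARD('n)"
  shows "\<exists>s u v. partial_svd (Suc k) M s u v"
proof -
  define S where "S = {p. norm (fst p) = 1 \<and> norm (snd p) = 1 \<and>
    (\<forall>i\<in>{1..k}. fst p \<bullet> u i = 0 \<and> snd p \<bullet> v i = 0)}"
  have ou: "orthonormal_on {1..k} u" and ov: "orthonormal_on {1..k} v"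
    and sv: "\<And>i. i \<in> {1..k} \<Longrightarrow> 0 \<le> s i" "\<And>i. i \<in> {1..k} \<Longrightarrow> M *v v i = s i *\<^sub>R u i"
       "\<And>i. i \<in> {1..k} \<Longrightarrow> u i v* M = s i *\<^sub>R v i"
    and dec: "\<And>i j. i \<in> {1..k} \<Longrightarrow> j \<in> {1..k} \<Longrightarrow> i \<le> j \<Longrightarrow> s j \<le> s i"
    and bnd: "\<And>x y i. norm x = 1 \<Longrightarrow> norm y = 1 \<Longrightarrow>
       (\<And>i. i \<in> {1..k} \<Longrightarrow> x \<bullet> v i = 0 \<and> y \<bullet> u i = 0) \<Longrightarrow> i \<in> {1..k} \<Longrightarrow> y \<bullet> (M *v x) \<le> s i"
    using P unfolding partial_svd_def by blast+
  have "S \<noteq> {}"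
  proof -
    obtain y :: "real^'m" where "norm y = 1" "\<And>j. j \<in> {1..k} \<Longrightarrow> y \<bullet> u j = 0"
      using unit_vector_orthogonal_to_family[of "{1..k}" u] k by auto
    moreover obtain x :: "real^'n" where "norm x = 1" "\<And>j. j \<in> {1..k} \<Longrightarrow> x \<bullet> v j = 0"
      using unit_vector_orthogonal_to_family[of "{1..k}" v] k by auto
    ultimately have "(y, x) \<in> S" by (simp add: S_def)
    then show ?thesis by blast
  qed
  moreover have "compact S"
  proof -
    have eq: "S = (sphere 0 1 \<times> sphere 0 1) \<inter>
        (\<Inter>i\<in>{1..k}. {p. fst p \<bullet> u i = 0} \<inter> {p. snd p \<bullet> v i = 0})"
      unfolding S_def by auto
    have "closed {p :: (real^'m) \<times> (real^'n). fst p \<bullet> u i = 0}"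
        "closed {p :: (real^'m) \<times> (real^'n). snd p \<bullet> v i = 0}" for i
      by (intro closed_Collect_eq continuous_intros)+
    then show ?thesis
      unfolding eq by (intro compact_Int_closed compact_Times compact_sphere closed_INT ballI closed_Int)
  qed
  moreover have "continuous_on S (\<lambda>p. fst p \<bullet> (M *v snd p))"
  proof (rule continuous_on_inner)
    show "continuous_on S (\<lambda>p. M *v snd p)"
      by (rule continuous_on_compose2[OF matrix_vector_mult_linear_continuous_on[of UNIV M]
            continuous_on_snd[OF continuous_on_id]]) auto
  qed (rule continuous_on_fst[OF continuous_on_id])
  ultimately have "\<exists>p\<in>S. \<forall>p'\<in>S. fst p' \<bullet> (M *v snd p') \<le> fst p \<bullet> (M *v snd p)"
    by (intro continuous_attains_sup)
  then obtain p where p: "p \<in> S"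
    "\<And>p'. p' \<in> S \<Longrightarrow> fst p' \<bullet> (M *v snd p') \<le> fst p \<bullet> (M *v snd p)"
    by blast
  obtain y x where yx: "p = (y, x)" by (cases p)
  define t where "t = y \<bullet> (M *v x)"
  have ny: "norm y = 1" and nx: "norm x = 1"
    and oy: "\<And>i. i \<in> {1..k} \<Longrightarrow> y \<bullet> u i = 0" and ox: "\<And>i. i \<in> {1..k} \<Longrightarrow> x \<bullet> v i = 0"
    using p(1) by (auto simp: S_def yx)
  have mx: "y' \<bullet> (M *v x') \<le> t" if "norm y' = 1" "norm x' = 1"
    "\<And>i. i \<in> {1..k} \<Longrightarrow> y' \<bullet> u i = 0" "\<And>i. i \<in> {1..k} \<Longrightarrow> x' \<bullet> v i = 0" for x' y'
    using p(2)[of "(y', x')"] that by (simp add: S_def yx t_def)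
  \<comment> \<open>Replacing \<open>y\<close> by \<open>-y\<close> changes the sign of the form, so its maximum is not negative.\<close>
  have t0: "0 \<le> t"
    using mx[of "- y" x] ny nx oy ox by (simp add: t_def)
  have Mx: "M *v x = t *\<^sub>R y"
  proof (rule unit_vector_extremal_eq)
    show "y \<bullet> (M *v x) = t" by (simp add: t_def)
    have "(M *v x) \<bullet> u i = 0" if "i \<in> {1..k}" for i
      using dot_lmul_matrix[of "u i" M x] sv(3)[OF that] ox[OF that]
      by (simp add: inner_commute)
    \<comment> \<open>\<open>M x\<close> is orthogonal to the earlier \<open>u i\<close>, so its direction competes in the maximum.\<close>
    then have "sgn (M *v x) \<bullet> (M *v x) \<le> t" if "M *v x \<noteq> 0"
      using that by (intro mx) (simp_all add: norm_sgn nx ox sgn_div_norm)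
    then show "(M *v x) \<bullet> (M *v x) \<le> t * norm (M *v x)"
      by (cases "M *v x = 0") (simp_all add: sgn_div_norm field_simps)
  qed (use ny t0 in auto)
  have yM: "y v* M = t *\<^sub>R x"
  proof (rule unit_vector_extremal_eq)
    show "x \<bullet> (y v* M) = t" by (simp add: t_def inner_commute[of x] dot_lmul_matrix)
    have "(y v* M) \<bullet> v i = 0" if "i \<in> {1..k}" for i
      using sv(2)[OF that] oy[OF that] by (simp add: dot_lmul_matrix)
    then have "y \<bullet> (M *v sgn (y v* M)) \<le> t" if "y v* M \<noteq> 0"
      using that by (intro mx) (simp_all add: norm_sgn ny oy sgn_div_norm)
    then have "sgn (y v* M) \<bullet> (y v* M) \<le> t" if "y v* M \<noteq> 0"
      using that by (simp add: inner_commute flip: dot_lmul_matrix)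
    then show "(y v* M) \<bullet> (y v* M) \<le> t * norm (y v* M)"
      by (cases "y v* M = 0") (simp_all add: sgn_div_norm field_simps)
  qed (use nx t0 in auto)
  have ts: "t \<le> s i" if "i \<in> {1..k}" for i
    unfolding t_def using bnd[OF nx ny _ that] ox oy by blast
  have "partial_svd (Suc k) M (s(Suc k := t)) (u(Suc k := y)) (v(Suc k := x))"
    unfolding partial_svd_def
  proof (intro conjI allI impI ballI)
    show "orthonormal_on {1..Suc k} (u(Suc k := y))" "orthonormal_on {1..Suc k} (v(Suc k := x))"
      using orthonormal_on_Suc ou ov ny nx ox oy by blast+
  next
    fix i j assume ij: "i \<in> {1..Suc k}" "j \<in> {1..Suc k}" "i \<le> j"
    then show "(s(Suc k := t)) j \<le> (s(Suc k := t)) i"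
      using ts[of i] dec[of i j] by (auto simp: le_Suc_eq)
  next
    fix x' y' i
    assume *: "norm x' = 1" "norm y' = 1" "i \<in> {1..Suc k}"
      "\<forall>i\<in>{1..Suc k}. x' \<bullet> (v(Suc k := x)) i = 0 \<and> y' \<bullet> (u(Suc k := y)) i = 0"
    have o: "x' \<bullet> v i = 0 \<and> y' \<bullet> u i = 0" if "i \<in> {1..k}" for i
      using *(4)[rule_format, of i] that by auto
    show "y' \<bullet> (M *v x') \<le> (s(Suc k := t)) i"
      using mx[of y' x'] bnd[of x' y' i] * o by (auto simp: le_Suc_eq)
  next
    fix i assume i: "i \<in> {1..Suc k}"
    then consider "i = Suc k" | "i \<in> {1..k}" by fastforce
    then show "0 \<le> (s(Suc k := t)) i"
      "M *v (v(Suc k := x)) i = (s(Suc k := t)) i *\<^sub>R (u(Suc k := y)) i"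
      "(u(Suc k := y)) i v* M = (s(Suc k := t)) i *\<^sub>R (v(Suc k := x)) i"
      by (cases; use t0 Mx yM sv in auto)+
  qed
  then show ?thesis by blast
qed

lemma partial_svd_exists:
  fixes M :: "real^'n^'m"
  shows "k \<le> min CARD('m) CARD('n) \<Longrightarrow> \<exists>s u v. partial_svd k M s u v"
proof (induction k)
  case 0
  show ?case by (simp add: partial_svd_def orthonormal_on_def)
next
  case (Suc k)
  then show ?case using partial_svd_Suc[of k M] by auto
qed

lemma is_svd_iff:
  fixes M :: "real^'n^'m"
  defines "K \<equiv> {1..min CARD('m) CARD('n)}"
  shows "is_svd M s u v \<longleftrightarrow> (\<forall>i\<in>K. 0 \<le> s i) \<and> (\<forall>i\<in>K. \<forall>j\<in>K. i \<le> j \<longrightarrow> s j \<le> s i) \<and>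
    orthonormal_on K u \<and> orthonormal_on K v \<and> M = (\<Sum>i\<in>K. s i *\<^sub>R outer_product (u i) (v i))"
  unfolding is_svd_def K_def orthonormal_on_def Let_def by blast

theorem svd_exists:
  fixes M :: "real^'n^'m"
  obtains s u v where "is_svd M s u v"
proof -
  define K where "K = {1..min CARD('m) CARD('n)}"
  obtain s u v where P: "partial_svd (min CARD('m) CARD('n)) M s u v"
    using partial_svd_exists[of "min CARD('m) CARD('n)" M] by auto
  have ou: "orthonormal_on K u" and ov: "orthonormal_on K v"
    and sv: "\<And>i. i \<in> K \<Longrightarrow> 0 \<le> s i" "\<And>i. i \<in> K \<Longrightarrow> M *v v i = s i *\<^sub>R u i"
       "\<And>i. i \<in> K \<Longrightarrow> u i v* M = s i *\<^sub>R v i"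
    and dec: "\<And>i j. i \<in> K \<Longrightarrow> j \<in> K \<Longrightarrow> i \<le> j \<Longrightarrow> s j \<le> s i"
    using P unfolding partial_svd_def K_def by blast+
  have fK: "finite K" by (simp add: K_def)
  \<comment> \<open>The remainder \<open>N\<close> vanishes because the singular vectors fill the smaller of the two spaces.\<close>
  define N where "N = M - (\<Sum>i\<in>K. s i *\<^sub>R outer_product (u i) (v i))"
  have Nx: "N *v x = M *v x - (\<Sum>i\<in>K. (s i * (v i \<bullet> x)) *\<^sub>R u i)" for x
    unfolding N_def matrix_vector_mult_diff_rdistrib sum_outer_product_mult_vec ..
  have Nu: "(N *v x) \<bullet> u i = 0" if "i \<in> K" for x i
    using orthonormal_on_inner_sum[OF fK ou that, of "\<lambda>i. s i * (v i \<bullet> x)"]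
      dot_lmul_matrix[of "u i" M x] sv(3)[OF that]
    by (simp add: Nx inner_diff_left inner_diff_right inner_commute)
  have Nv: "N *v v i = 0" if "i \<in> K" for i
  proof -
    have "(\<Sum>j\<in>K. (s j * (v j \<bullet> v i)) *\<^sub>R u j) = (\<Sum>j\<in>K. if j = i then s j *\<^sub>R u j else 0)"
      using ov that by (intro sum.cong) (auto simp: orthonormal_on_def)
    then show ?thesis using sv(2)[OF that] that fK by (simp add: Nx)
  qed
  have "N = 0"
  proof (cases "CARD('m) \<le> CARD('n)")
    case True
    then have "card K = DIM(real^'m)" by (simp add: K_def)
    then have "N *v x = 0" for x
      using orthonormal_on_complete[OF fK ou] Nu by blast
    then show ?thesis by (simp add: matrix_eq)
  next
    case False
    then have "card K = DIM(real^'n)" by (simp add: K_def)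
    then have "y v* N = 0" for y
      using orthonormal_on_complete[OF fK ov] Nv by (simp add: dot_lmul_matrix)
    then have "y \<bullet> (N *v x) = 0" for x y
      by (metis dot_lmul_matrix inner_zero_left)
    then have "N *v x = 0" for x
      by (metis inner_eq_zero_iff)
    then show ?thesis by (simp add: matrix_eq)
  qed
  then have "is_svd M s u v"
    unfolding is_svd_iff K_def[symmetric] using ou ov sv(1) dec by (auto simp: N_def)
  then show thesis by (rule that)
qed

section \<open>Pairing with partial isometries and uniqueness of singular values\<close>

text \<open>
  Here \<open>w i = (u i)\<^sup>T W (v i)\<close> for the partial isometry \<open>W = \<Sum>\<^sub>j a\<^sub>j b\<^sub>j\<^sup>T\<close>. Both bounds on \<open>w\<close> are
  Bessel's inequality after \<open>2 \<bar>p q\<bar> \<le> p\<^sup>2 + q\<^sup>2\<close>: the first for the families \<open>a\<close>, \<open>b\<close>, the second for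
  \<open>u\<close>, \<open>v\<close>.
\<close>

lemma svd_inner_partial_isometry:
  fixes M :: "real^'n^'m" and a :: "'i \<Rightarrow> real^'m"
  defines "K \<equiv> {1..min CARD('m) CARD('n)}"
  assumes svd: "is_svd M s u v"
    and J: "finite J" "orthonormal_on J a" "orthonormal_on J b"
  obtains w where "M \<bullet> (\<Sum>j\<in>J. outer_product (a j) (b j)) = (\<Sum>i\<in>K. s i * w i)"
    "\<And>i. i \<in> K \<Longrightarrow> \<bar>w i\<bar> \<le> 1" "(\<Sum>i\<in>K. \<bar>w i\<bar>) \<le> real (card J)"
proof
  define w where "w i = (\<Sum>j\<in>J. (u i \<bullet> a j) * (v i \<bullet> b j))" for i
  have ou: "orthonormal_on K u" and ov: "orthonormal_on K v"
    and M: "M = (\<Sum>i\<in>K. s i *\<^sub>R outer_product (u i) (v i))"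
    using svd unfolding is_svd_iff K_def by blast+
  have "M \<bullet> (\<Sum>j\<in>J. outer_product (a j) (b j)) = (\<Sum>j\<in>J. \<Sum>i\<in>K. s i * (v i \<bullet> b j) * (u i \<bullet> a j))"
    unfolding inner_sum_right inner_outer_product M sum_outer_product_mult_vec
    by (simp add: inner_commute)
  also have "\<dots> = (\<Sum>i\<in>K. s i * w i)"
    by (subst sum.swap) (simp add: w_def sum_distrib_left mult_ac)
  finally show "M \<bullet> (\<Sum>j\<in>J. outer_product (a j) (b j)) = (\<Sum>i\<in>K. s i * w i)" .
  have "\<bar>p * q\<bar> \<le> (p\<^sup>2 + q\<^sup>2) / 2" for p q :: real
    using sum_squares_bound[of "\<bar>p\<bar>" "\<bar>q\<bar>"] by (simp add: abs_mult)
  then have wle: "\<bar>w i\<bar> \<le> (\<Sum>j\<in>J. ((u i \<bullet> a j)\<^sup>2 + (v i \<bullet> b j)\<^sup>2) / 2)" for i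
    unfolding w_def by (intro order_trans[OF sum_abs] sum_mono)
  show "\<bar>w i\<bar> \<le> 1" if "i \<in> K" for i
  proof -
    have "u i \<bullet> u i = 1" "v i \<bullet> v i = 1"
      using ou ov that by (auto simp: orthonormal_on_def)
    then have "(\<Sum>j\<in>J. (u i \<bullet> a j)\<^sup>2) \<le> 1" "(\<Sum>j\<in>J. (v i \<bullet> b j)\<^sup>2) \<le> 1"
      using bessel_inequality[OF J(1,2), of "u i"] bessel_inequality[OF J(1,3), of "v i"] by auto
    then show ?thesis
      using wle[of i] by (simp add: sum.distrib flip: sum_divide_distrib)
  qed
  have "(\<Sum>i\<in>K. \<bar>w i\<bar>) \<le> (\<Sum>i\<in>K. \<Sum>j\<in>J. ((u i \<bullet> a j)\<^sup>2 + (v i \<bullet> b j)\<^sup>2) / 2)"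
    by (intro sum_mono wle)
  also have "\<dots> = (\<Sum>j\<in>J. ((\<Sum>i\<in>K. (a j \<bullet> u i)\<^sup>2) + (\<Sum>i\<in>K. (b j \<bullet> v i)\<^sup>2)) / 2)"
    by (subst sum.swap) (simp add: inner_commute sum.distrib flip: sum_divide_distrib)
  also have "\<dots> \<le> (\<Sum>j\<in>J. 1)"
  proof (intro sum_mono)
    fix j assume "j \<in> J"
    then have "a j \<bullet> a j = 1" "b j \<bullet> b j = 1"
      using J by (auto simp: orthonormal_on_def)
    moreover have "finite K" by (simp add: K_def)
    ultimately show "((\<Sum>i\<in>K. (a j \<bullet> u i)\<^sup>2) + (\<Sum>i\<in>K. (b j \<bullet> v i)\<^sup>2)) / 2 \<le> 1"
      using bessel_inequality[of K u "a j"] bessel_inequality[of K v "b j"] ou ov by simp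
  qed
  finally show "(\<Sum>i\<in>K. \<bar>w i\<bar>) \<le> real (card J)" by simp
qed

text \<open>
  Half of Ky Fan's principle, with the partial isometry taken from the second decomposition.
\<close>

lemma svd_leading_sum_le:
  fixes M :: "real^'n^'m"
  assumes svd: "is_svd M s u v" and svd': "is_svd M s' u' v'"
    and k: "1 \<le> k" "k \<le> min CARD('m) CARD('n)"
  shows "(\<Sum>i=1..k. s' i) \<le> (\<Sum>i=1..k. s i)"
proof -
  define K where "K = {1..min CARD('m) CARD('n)}"
  have kK: "{1..k} \<subseteq> K" "finite K" using k by (auto simp: K_def)
  have ou: "orthonormal_on K u'" and ov: "orthonormal_on K v'"
    and M: "M = (\<Sum>i\<in>K. s' i *\<^sub>R outer_product (u' i) (v' i))"
    using svd' unfolding is_svd_iff K_def by blast+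
  have "u' i \<bullet> (M *v v' i) = s' i" if "i \<in> K" for i
    unfolding M sum_outer_product_mult_vec
      orthonormal_on_inner_sum[OF kK(2) ou that]
    using ov that by (simp add: orthonormal_on_def)
  then have "(\<Sum>i=1..k. s' i) = M \<bullet> (\<Sum>j=1..k. outer_product (u' j) (v' j))"
    using kK by (auto simp: inner_sum_right inner_outer_product intro!: sum.cong)
  moreover obtain w where
    w: "M \<bullet> (\<Sum>j=1..k. outer_product (u' j) (v' j)) = (\<Sum>i\<in>K. s i * w i)"
    "\<And>i. i \<in> K \<Longrightarrow> \<bar>w i\<bar> \<le> 1" "(\<Sum>i\<in>K. \<bar>w i\<bar>) \<le> real (card {1..k})"
    using svd_inner_partial_isometry[OF svd, of "{1..k}" u' v']
      orthonormal_on_subset[OF ou kK(1)] orthonormal_on_subset[OF ov kK(1)]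
    unfolding K_def by blast
  moreover have "(\<Sum>i\<in>K. s i * w i) \<le> (\<Sum>i=1..k. s i)"
  proof -
    let ?d = "\<lambda>i. if i \<le> k then 1 else 0 :: real"
    have split: "(\<Sum>i\<in>K. g i * ?d i) = (\<Sum>i=1..k. g i)" for g
    proof -
      have "(\<Sum>i\<in>K. g i * ?d i) = (\<Sum>i\<in>{1..k}. g i * ?d i)"
        by (intro sum.mono_neutral_right kK) (auto simp: K_def)
      then show ?thesis by simp
    qed
    \<comment> \<open>The threshold \<open>s k\<close> separates the leading values from the others: weight missing at a
      leading index loses at least \<open>s k\<close> per unit, weight at a later index gains at most \<open>s k\<close>.\<close>
    have "s i * w i \<le> s i * ?d i + s k * (\<bar>w i\<bar> - ?d i)" if i: "i \<in> K" for i
    proof (cases "i \<le> k")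
      case True
      have "0 \<le> s i" "s k \<le> s i" using svd i k True unfolding is_svd_iff K_def by auto
      then have "s i * w i \<le> s i * \<bar>w i\<bar>" "(s i - s k) * (1 - \<bar>w i\<bar>) \<ge> 0"
        using w(2)[OF i] by (auto intro: mult_left_mono)
      then show ?thesis using True by (simp add: algebra_simps)
    next
      case False
      have "0 \<le> s i" "s i \<le> s k" using svd i k False unfolding is_svd_iff K_def by auto
      then have "s i * w i \<le> s i * \<bar>w i\<bar>" "s i * \<bar>w i\<bar> \<le> s k * \<bar>w i\<bar>"
        by (auto intro: mult_left_mono mult_right_mono)
      then show ?thesis using False by simp
    qed
    then have "(\<Sum>i\<in>K. s i * w i) \<le> (\<Sum>i\<in>K. s i * ?d i + s k * (\<bar>w i\<bar> - ?d i))"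
      by (rule sum_mono)
    also have "\<dots> = (\<Sum>i=1..k. s i) + s k * ((\<Sum>i\<in>K. \<bar>w i\<bar>) - (\<Sum>i\<in>K. 1 * ?d i))"
      by (simp only: sum.distrib split sum_subtractf mult_1 flip: sum_distrib_left)
    also have "(\<Sum>i\<in>K. 1 * ?d i) = k"
      unfolding split by simp
    also have "s k * ((\<Sum>i\<in>K. \<bar>w i\<bar>) - k) \<le> 0"
      using w(3) svd k unfolding is_svd_iff by (auto intro!: mult_nonneg_nonpos)
    finally show ?thesis by simp
  qed
  ultimately show ?thesis by simp
qed

lemma svd_values_unique:
  fixes M :: "real^'n^'m"
  assumes "is_svd M s u v" "is_svd M s' u' v'" "i \<in> {1..min CARD('m) CARD('n)}"
  shows "s' i = s i"
proof -
  have *: "(\<Sum>i=1..k. s' i) = (\<Sum>i=1..k. s i)" if "k \<le> min CARD('m) CARD('n)" for k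
    using svd_leading_sum_le[OF assms(1,2), of k] svd_leading_sum_le[OF assms(2,1), of k] that
    by (cases "k = 0") auto
  obtain j where "i = Suc j" using assms(3) by (cases i) auto
  then show ?thesis using *[of i] *[of j] assms(3) by simp
qed

lemma singular_value_eq:
  fixes M :: "real^'n^'m"
  assumes "is_svd M s u v" "i \<in> {1..min CARD('m) CARD('n)}"
  shows "singular_value M i = s i"
  unfolding singular_value_def
  by (rule the_equality) (use assms svd_values_unique in blast)+

section \<open>Schatten norms\<close>

lemma schatten_norm_svd:
  fixes M :: "real^'n^'m"
  assumes "is_svd M s u v"
  shows "schatten_norm q M = (if q = \<infinity> then s 1 else
    (\<Sum>i = 1..min CARD('m) CARD('n). s i powr real_of_ereal q) powr (1 / real_of_ereal q))"
proof -
  have "1 \<in> {1..min CARD('m) CARD('n)}" using zero_less_card_finite by (simp add: Suc_leI)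
  then show ?thesis
    unfolding schatten_norm_def using singular_value_eq[OF assms] by simp
qed

lemma schatten_norm_nonneg: "0 \<le> schatten_norm q M"
  for M :: "real^'n^'m"
proof -
  obtain s u v where svd: "is_svd M s u v" by (rule svd_exists)
  have "1 \<in> {1..min CARD('m) CARD('n)}" using zero_less_card_finite by (simp add: Suc_leI)
  then have "0 \<le> s 1" using svd unfolding is_svd_iff by blast
  then show ?thesis by (simp add: schatten_norm_svd[OF svd])
qed

text \<open>The convex function \<open>s \<mapsto> s\<^bsup>q\<^esup>\<close> lies above its tangent at \<open>\<tau>\<close>.\<close>

lemma powr_tangent_le:
  fixes s \<tau> q :: real
  assumes "0 \<le> s" "0 < \<tau>" "1 \<le> q"
  shows "\<tau> powr q * (1 - q) + q * \<tau> powr (q - 1) * s \<le> s powr q"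
proof (cases "s = 0")
  case True
  then show ?thesis using assms by (simp add: mult_nonneg_nonpos)
next
  case False
  then have s: "0 < s" using assms by simp
  have "(s powr q) powr (1 / q) * (\<tau> powr q) powr (1 - 1 / q)
      \<le> 1 / q * s powr q + (1 - 1 / q) * \<tau> powr q"
    by (rule Youngs_inequality_0) (use assms s in auto)
  moreover have "q * (1 - 1 / q) = q - 1" using assms by (simp add: field_simps)
  ultimately have "s * \<tau> powr (q - 1) \<le> 1 / q * s powr q + (1 - 1 / q) * \<tau> powr q"
    using assms s by (simp add: powr_powr)
  then have "q * (s * \<tau> powr (q - 1)) \<le> q * (1 / q * s powr q + (1 - 1 / q) * \<tau> powr q)"
    using assms by (intro mult_left_mono) auto
  moreover have "q * (1 / q * s powr q + (1 - 1 / q) * \<tau> powr q) = s powr q + (q - 1) * \<tau> powr q"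
    using assms by (simp add: field_simps)
  ultimately show ?thesis by (simp add: algebra_simps)
qed

text \<open>
  Hoelder's inequality \<open>\<langle>M, W\<rangle> \<le> k\<^bsup>1 - 1/q\<^esup> \<parallel>M\<parallel>\<^sub>q\<close> for a partial isometry \<open>W\<close> of rank \<open>k\<close>, in terms
  of a positive lower bound \<open>k \<tau>\<close> for the left-hand side. For finite \<open>q\<close> it is the tangent inequality at \<open>\<tau>\<close>,
  summed with the weights \<open>\<bar>w i\<bar>\<close>.
\<close>

lemma schatten_norm_lower_bound:
  fixes M :: "real^'n^'m" and a :: "'i \<Rightarrow> real^'m"
  assumes J: "finite J" "orthonormal_on J a" "orthonormal_on J b" "J \<noteq> {}"
    and \<tau>: "0 < \<tau>" "real (card J) * \<tau> \<le> M \<bullet> (\<Sum>j\<in>J. outer_product (a j) (b j))" and q: "1 \<le> q"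
  shows "real (card J) powr real_of_ereal (1 / q) * \<tau> \<le> schatten_norm q M"
proof -
  define K where "K = {1..min CARD('m) CARD('n)}"
  define k where "k = real (card J)"
  have k0: "0 < k" using J by (simp add: k_def card_gt_0_iff)
  obtain s u v where svd: "is_svd M s u v" by (rule svd_exists)
  obtain w where w0: "M \<bullet> (\<Sum>j\<in>J. outer_product (a j) (b j)) = (\<Sum>i\<in>K. s i * w i)"
    and w1: "\<And>i. i \<in> K \<Longrightarrow> \<bar>w i\<bar> \<le> 1" and wk: "(\<Sum>i\<in>K. \<bar>w i\<bar>) \<le> k"
    using svd_inner_partial_isometry[OF svd J(1,2,3)] unfolding K_def k_def by blast
  have s0: "0 \<le> s i" if "i \<in> K" for i
    using svd that unfolding is_svd_iff K_def by blast
  have "(\<Sum>i\<in>K. s i * w i) \<le> (\<Sum>i\<in>K. s i * \<bar>w i\<bar>)"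
    by (intro sum_mono mult_left_mono) (auto simp: s0)
  then have low: "k * \<tau> \<le> (\<Sum>i\<in>K. s i * \<bar>w i\<bar>)"
    using \<tau>(2) w0 by (simp add: k_def)
  show ?thesis
  proof (cases "q = \<infinity>")
    case True
    have one: "1 \<in> K" unfolding K_def using zero_less_card_finite by (simp add: Suc_leI)
    have "(\<Sum>i\<in>K. s i * \<bar>w i\<bar>) \<le> (\<Sum>i\<in>K. s 1 * \<bar>w i\<bar>)"
      using svd one unfolding is_svd_iff K_def
      by (intro sum_mono mult_right_mono) auto
    also have "\<dots> \<le> s 1 * k"
      unfolding sum_distrib_left[symmetric] using s0[OF one] wk by (intro mult_left_mono)
    finally have "\<tau> \<le> s 1"
      using low k0 by (smt (verit) mult.commute mult_le_cancel_left_pos)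
    then show ?thesis using True k0 by (simp add: schatten_norm_svd[OF svd] k_def)
  next
    case False
    then obtain p where p: "q = ereal p" "1 \<le> p"
      using q by (cases q) auto
    have "k * \<tau> powr p = \<tau> powr p * (1 - p) * k + p * \<tau> powr (p - 1) * (k * \<tau>)"
    proof -
      have "\<tau> powr (p - 1) * \<tau> = \<tau> powr p" using \<tau>(1) by (simp add: powr_diff mult.commute)
      then have eq: "p * \<tau> powr (p - 1) * (k * \<tau>) = p * \<tau> powr p * k" by (metis mult.assoc mult.commute)
      show ?thesis unfolding eq by (simp add: algebra_simps)
    qed
    \<comment> \<open>The total weight is at most \<open>k\<close>, and its coefficient is nonpositive since \<open>1 \<le> p\<close>.\<close>
    also have "\<dots> \<le> \<tau> powr p * (1 - p) * (\<Sum>i\<in>K. \<bar>w i\<bar>)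
        + p * \<tau> powr (p - 1) * (\<Sum>i\<in>K. s i * \<bar>w i\<bar>)"
      using low wk p by (intro add_mono mult_left_mono mult_left_mono_neg)
        (auto intro: mult_nonneg_nonpos)
    also have "\<dots> = (\<Sum>i\<in>K. \<bar>w i\<bar> * (\<tau> powr p * (1 - p) + p * \<tau> powr (p - 1) * s i))"
      by (simp only: sum_distrib_left sum.distrib[symmetric]) (simp add: algebra_simps)
    also have "\<dots> \<le> (\<Sum>i\<in>K. \<bar>w i\<bar> * s i powr p)"
      using s0 \<tau>(1) p by (intro sum_mono mult_left_mono powr_tangent_le) auto
    also have "\<dots> \<le> (\<Sum>i\<in>K. s i powr p)"
      using w1 by (intro sum_mono mult_left_le_one_le) auto
    finally have "(k * \<tau> powr p) powr (1 / p) \<le> (\<Sum>i\<in>K. s i powr p) powr (1 / p)"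
      using k0 p by (intro powr_mono2) auto
    moreover have "(k * \<tau> powr p) powr (1 / p) = k powr (1 / p) * \<tau>"
      using k0 \<tau>(1) p by (simp add: powr_mult powr_powr)
    moreover have "real_of_ereal (1 / q) = 1 / p"
      using p by (simp add: one_ereal_def)
    ultimately show ?thesis
      using p by (simp add: schatten_norm_svd[OF svd] k_def K_def)
  qed
qed

section \<open>Matrices with equal nonzero singular values\<close>

text \<open>
  The singular vectors are \<open>u\<close> and \<open>v\<close>, permuted so that the indices in \<open>S\<close> come first.
\<close>

lemma is_svd_flat:
  fixes u :: "nat \<Rightarrow> real^'m" and v :: "nat \<Rightarrow> real^'n"
  defines "K \<equiv> {1..min CARD('m) CARD('n)}"
  assumes "orthonormal_on K u" "orthonormal_on K v" "S \<subseteq> K" "card S = r" "0 \<le> c"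
  shows "\<exists>u' v'. is_svd (\<Sum>i\<in>S. c *\<^sub>R outer_product (u i) (v i)) (\<lambda>i. if i \<le> r then c else 0) u' v'"
proof -
  have fK: "finite K" "finite S" using assms(4) by (auto simp: K_def intro: finite_subset)
  have rK: "{1..r} \<subseteq> K"
    using card_mono[OF fK(1) assms(4)] assms(5) by (auto simp: K_def)
  have "card {1..r} = card S" using assms(5) by simp
  then obtain f where f: "bij_betw f {1..r} S"
    using fK by (meson finite_atLeastAtMost finite_same_card_bij)
  have "card (K - {1..r}) = card (K - S)"
    using fK rK assms(4,5) by (simp add: card_Diff_subset)
  then obtain g where g: "bij_betw g (K - {1..r}) (K - S)"
    using fK by (meson finite_Diff finite_same_card_bij)
  define \<pi> where "\<pi> i = (if i \<in> {1..r} then f i else g i)" for i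
  have f': "bij_betw \<pi> {1..r} S"
    using f by (rule bij_betw_cong[THEN iffD1, rotated]) (simp add: \<pi>_def)
  have "bij_betw \<pi> (K - {1..r}) (K - S)"
    using g by (rule bij_betw_cong[THEN iffD1, rotated]) (auto simp: \<pi>_def)
  from bij_betw_combine[OF f' this] have "bij_betw \<pi> ({1..r} \<union> (K - {1..r})) (S \<union> (K - S))"
    by blast
  then have bij: "bij_betw \<pi> K K"
    using rK assms(4) by (simp add: Un_absorb1)
  let ?s = "\<lambda>i. if i \<le> r then c else 0"
  have "(\<Sum>i\<in>S. c *\<^sub>R outer_product (u i) (v i))
      = (\<Sum>i=1..r. c *\<^sub>R outer_product (u (\<pi> i)) (v (\<pi> i)))"
    by (rule sum.reindex_bij_betw[OF f', symmetric])
  also have "\<dots> = (\<Sum>i=1..r. ?s i *\<^sub>R outer_product ((u \<circ> \<pi>) i) ((v \<circ> \<pi>) i))"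
    by (intro sum.cong) auto
  also have "\<dots> = (\<Sum>i\<in>K. ?s i *\<^sub>R outer_product ((u \<circ> \<pi>) i) ((v \<circ> \<pi>) i))"
    by (intro sum.mono_neutral_left fK rK) (auto simp: K_def)
  finally have "is_svd (\<Sum>i\<in>S. c *\<^sub>R outer_product (u i) (v i)) ?s (u \<circ> \<pi>) (v \<circ> \<pi>)"
    unfolding is_svd_iff K_def[symmetric]
    using assms(6) orthonormal_on_reindex[OF assms(2), of \<pi> K]
      orthonormal_on_reindex[OF assms(3), of \<pi> K] bij
    by (auto simp: bij_betw_def)
  then show ?thesis by blast
qed

text \<open>
  The truncation is chosen from all decompositions. Each of them has the same singular values, zero
  beyond index \<open>r\<close>, so truncating changes nothing.
\<close>

lemma schatten_norm_max_part_flat: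
  fixes u :: "nat \<Rightarrow> real^'m" and v :: "nat \<Rightarrow> real^'n"
  defines "K \<equiv> {1..min CARD('m) CARD('n)}"
  assumes "orthonormal_on K u" "orthonormal_on K v" "S \<subseteq> K" "card S = r" "0 < r" "0 \<le> c" "1 \<le> q"
  shows "schatten_norm q (max_part r (\<Sum>i\<in>S. c *\<^sub>R outer_product (u i) (v i)))
    = real r powr real_of_ereal (1 / q) * c"
proof -
  define Z where "Z = (\<Sum>i\<in>S. c *\<^sub>R outer_product (u i) (v i))"
  let ?s = "\<lambda>i. if i \<le> r then c else 0"
  have fK: "finite K" by (simp add: K_def)
  have rK: "{1..r} \<subseteq> K"
    using card_mono[OF fK assms(4)] assms(5) by (auto simp: K_def)
  obtain u' v' where svd: "is_svd Z ?s u' v'"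
    using is_svd_flat[OF assms(2-5)[unfolded K_def] assms(7)] unfolding Z_def by blast
  have trunc: "(\<Sum>i=1..r. t i *\<^sub>R outer_product (x i) (y i)) = Z" if "is_svd Z t x y" for t x y
  proof -
    have "t i = 0" if "i \<in> K - {1..r}" for i
      using svd_values_unique[OF svd \<open>is_svd Z t x y\<close>, of i] that by (auto simp: K_def)
    then have "(\<Sum>i=1..r. t i *\<^sub>R outer_product (x i) (y i))
        = (\<Sum>i\<in>K. t i *\<^sub>R outer_product (x i) (y i))"
      by (intro sum.mono_neutral_left fK rK) auto
    then show ?thesis using that unfolding is_svd_iff K_def by simp
  qed
  have "max_part r Z = Z"
    unfolding max_part_def by (rule some_equality) (use trunc svd in \<open>metis+\<close>)
  moreover have "schatten_norm q Z = real r powr real_of_ereal (1 / q) * c"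
  proof (cases "q = \<infinity>")
    case True
    then show ?thesis using assms(6) by (simp add: schatten_norm_svd[OF svd])
  next
    case False
    then obtain p where p: "q = ereal p" "1 \<le> p"
      using assms(8) by (cases q) auto
    have "(\<Sum>i\<in>K. ?s i powr p) = (\<Sum>i=1..r. ?s i powr p)"
      by (intro sum.mono_neutral_right fK rK) (auto simp: K_def)
    also have "\<dots> = r * c powr p" by simp
    finally have "(\<Sum>i\<in>K. ?s i powr p) powr (1 / p) = r powr (1 / p) * c"
      using p assms(7) by (simp add: powr_mult powr_powr)
    moreover have "real_of_ereal (1 / q) = 1 / p"
      using p by (simp add: one_ereal_def)
    ultimately show ?thesis
      using p by (simp add: schatten_norm_svd[OF svd] K_def)
  qed
  ultimately show ?thesis by (simp add: Z_def)
qed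

section \<open>The minimax lower bound\<close>

lemma le_worst_case_error:
  assumes "(A, Z, B) \<in> perturbation_class r q \<xi>" "x \<le> schatten_norm q (f B - A)"
  shows "ereal x \<le> worst_case_error r q \<xi> f"
  unfolding worst_case_error_def by (rule SUP_upper2[OF assms(1)]) (use assms(2) in simp)

lemma worst_case_error_lower_bound:
  fixes f :: "real^'n^'m \<Rightarrow> real^'n^'m" and q :: ereal
  assumes r: "0 < r" "2 * r \<le> min CARD('m) CARD('n)" and \<xi>: "0 \<le> \<xi>" and q: "1 \<le> q"
  shows "ereal (2 powr (real_of_ereal (1 / q) - 1) * \<xi>) \<le> worst_case_error r q \<xi> f"
proof -
  define K where "K = {1..min CARD('m) CARD('n)}"
  obtain s u v where svd0: "is_svd (0 :: real^'n^'m) s u v" by (rule svd_exists)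
  \<comment> \<open>A decomposition of the zero matrix serves only to supply orthonormal families on \<open>K\<close>.\<close>
  have ou: "orthonormal_on K u" and ov: "orthonormal_on K v"
    using svd0 unfolding is_svd_iff K_def by blast+
  define flat where "flat S c = (\<Sum>i\<in>S. c *\<^sub>R outer_product (u i) (v i))" for S c
  define S1 S2 where "S1 = {1..r}" and "S2 = {r+1..2*r}"
  have S: "S1 \<subseteq> K" "S2 \<subseteq> K" "card S1 = r" "card S2 = r" "finite S1" "finite S2"
    "S1 \<inter> S2 = {}"
    using r by (auto simp: S1_def S2_def K_def)
  define \<alpha> where "\<alpha> = real_of_ereal (1 / q)"
  have mem: "(flat T c, flat T' c', flat T c + flat T' c') \<in> perturbation_class r q \<xi>"
    if "T \<subseteq> K" "T' \<subseteq> K" "card T = r" "card T' = r" "c \<noteq> 0" "0 \<le> c'" "real r powr \<alpha> * c' \<le> \<xi>" for T T' c c'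
  proof -
    have "rank (flat T c) = r"
      using rank_sum_outer_product[of T u v c] that orthonormal_on_subset ou ov
      by (metis flat_def K_def finite_atLeastAtMost finite_subset)
    moreover have "schatten_norm q (max_part r (flat T' c')) \<le> \<xi>"
      using schatten_norm_max_part_flat[OF ou[unfolded K_def] ov[unfolded K_def], of T' r c' q]
        that r(1) q by (simp add: K_def flat_def \<alpha>_def)
    ultimately show ?thesis by (simp add: perturbation_class_def)
  qed
  show ?thesis
  proof (cases "\<xi> = 0")
    case True
    \<comment> \<open>The scale \<open>c\<close> of the main case would be zero and violate the rank condition; a noiseless
      signal shows that the class is nonempty, which suffices for the bound zero.\<close>
    show ?thesis
      by (rule le_worst_case_error[OF mem[of S1 S2 1 0]])
        (use S True schatten_norm_nonneg in auto)
  next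
    case False
    define c where "c = \<xi> / real r powr \<alpha>"
    have c: "0 < c" "real r powr \<alpha> * c = \<xi>" using False \<xi> r by (simp_all add: c_def)
    define B where "B = flat S1 c + flat S2 c"
    have m1: "(flat S1 c, flat S2 c, B) \<in> perturbation_class r q \<xi>"
      and m2: "(flat S2 c, flat S1 c, B) \<in> perturbation_class r q \<xi>"
      using mem[of S1 S2 c c] mem[of S2 S1 c c] S c by (auto simp: B_def add.commute)
    define J where "J = S1 \<union> S2"
    have J: "finite J" "J \<subseteq> K" "card J = 2 * r" "J \<noteq> {}"
      using S r by (auto simp: J_def card_Un_disjoint)
    \<comment> \<open>The signs make \<open>W\<close> below the partial isometry \<open>(flat S1 c - flat S2 c) / c\<close>.\<close>
    define a where "a i = (if i \<in> S1 then u i else - u i)" for i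
    have "orthonormal_on J u" and oJv: "orthonormal_on J v"
      using orthonormal_on_subset ou ov J(2) by blast+
    then have oa: "orthonormal_on J a" "orthonormal_on J (\<lambda>i. - a i)"
      unfolding orthonormal_on_def a_def by auto
    define W where "W = (\<Sum>j\<in>J. outer_product (a j) (v j))"
    have W: "W \<bullet> flat T t = (\<Sum>i\<in>T. t * (if i \<in> S1 then 1 else -1))" if "T \<subseteq> J" for T t
    proof -
      have "u i \<bullet> (W *v v i) = (if i \<in> S1 then 1 else -1)" if "i \<in> J" for i
      proof -
        have "W *v v i = (\<Sum>j\<in>J. if j = i then a j else 0)"
          unfolding W_def sum_mult_vec outer_product_mult_vec
          using oJv that by (intro sum.cong) (auto simp: orthonormal_on_def)
        then show ?thesis
          using J(1) that ou J(2) by (auto simp: a_def orthonormal_on_def)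
      qed
      then show ?thesis
        using that by (auto simp: flat_def inner_sum_right inner_outer_product intro!: sum.cong)
    qed
    have W1: "W \<bullet> flat S1 c = r * c" using S by (simp add: W J_def)
    have "W \<bullet> flat S2 c = (\<Sum>i\<in>S2. - c)"
      unfolding W[of S2, unfolded J_def, simplified] using S by (intro sum.cong) auto
    then have W2: "W \<bullet> flat S2 c = - (r * c)" using S by simp
    have Wn: "(\<Sum>j\<in>J. outer_product (- a j) (v j)) = - W"
      unfolding W_def sum_negf[symmetric] by (intro sum.cong) (simp_all add: outer_product_def vec_eq_iff)
    have val: "real (card J) powr \<alpha> * (c / 2) = 2 powr (\<alpha> - 1) * \<xi>"
      using c r by (simp add: J powr_mult powr_diff flip: c(2))
    have "real (card J) * (c / 2) \<le> (f B - flat S2 c) \<bullet> W \<or>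
        real (card J) * (c / 2) \<le> (f B - flat S1 c) \<bullet> (- W)"
    proof -
      have "(f B - flat S2 c) \<bullet> W + (f B - flat S1 c) \<bullet> (- W) = W \<bullet> flat S1 c - W \<bullet> flat S2 c"
        by (simp add: inner_diff_left inner_diff_right inner_commute)
      also have "\<dots> = 2 * (r * c)" using W1 W2 by simp
      finally show ?thesis by (auto simp: J(3))
    qed
    then show ?thesis
    proof
      assume "real (card J) * (c / 2) \<le> (f B - flat S2 c) \<bullet> W"
      then have "real (card J) powr \<alpha> * (c / 2) \<le> schatten_norm q (f B - flat S2 c)"
        unfolding \<alpha>_def W_def using c(1) q
        by (intro schatten_norm_lower_bound[OF J(1) oa(1) oJv J(4)]) simp_all
      then show ?thesis
        unfolding val by (intro le_worst_case_error[OF m2]) (simp add: \<alpha>_def)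
    next
      assume "real (card J) * (c / 2) \<le> (f B - flat S1 c) \<bullet> (- W)"
      then have "real (card J) powr \<alpha> * (c / 2) \<le> schatten_norm q (f B - flat S1 c)"
        unfolding \<alpha>_def by (intro schatten_norm_lower_bound[OF J(1) oa(2) oJv J(4)])
          (use c(1) q in \<open>simp_all add: Wn\<close>)
      then show ?thesis
        unfolding val by (intro le_worst_case_error[OF m1]) (simp add: \<alpha>_def)
    qed
  qed
qed

text \<open>
  Each realization of a random estimator is itself a function of the observed matrix, so the bound
  for every single function covers both parts.
\<close>

theorem theorem4:
  fixes r :: nat and \<xi> :: real and q :: ereal
  assumes "0 < r" and "2 * r \<le> min CARD('m::finite) CARD('n::finite)"
    and "0 \<le> \<xi>" and "1 \<le> q"
  shows "ereal (2 powr (real_of_ereal (1 / q) - 1) * \<xi>)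
           \<le> (INF f :: real^'n^'m \<Rightarrow> real^'n^'m. worst_case_error r q \<xi> f)
       \<and> (\<forall>P :: 'w measure. prob_space P \<longrightarrow>
            (\<forall>\<omega> \<in> space P.
               ereal (2 powr (real_of_ereal (1 / q) - 1) * \<xi>)
                 \<le> (INF F \<in> (random_estimators P :: ('w \<Rightarrow> real^'n^'m \<Rightarrow> real^'n^'m) set).
                      worst_case_error r q \<xi> (F \<omega>))))"
  using worst_case_error_lower_bound[OF assms] by (auto intro!: INF_greatest)

end
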